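(* Let $G$ be a locally compact group and let $(\Phi,\Psi)$ be a complementary pair of Young functions satisfying the $\Delta_2$-condition. The Banach algebra $A_\Phi(G)$ is finite-dimensional if and only if $G$ is finite.
   Context: $G$ carries a fixed left Haar measure $dx$. A Young function is a symmetric convex $\Phi:\mathbb{R}\to[0,\infty]$ with $\Phi(0)=0$ and $\lim_{x\to\infty}\Phi(x)=+\infty$; its complementary Young function is $\Psi(y)=\sup\{x|y|-\Phi(x):x\ge 0\}$. $\Phi$ satisfies the $\Delta_2$-condition if it is finite-valued and there are $M>0$, $x_0>0$ with $\Phi(2x)\le M\Phi(x)$ for all $x\ge x_0$ when $G$ is compact, and the same with $x_0=0$ when $G$ is non-compact; the pair $(\Phi,\Psi)$ satisfies $\Delta_2$ if both functions do. The Orlicz space $L^\Phi(G)$ consists of (classes of) measurable $f:G\to\mathbb{C}$ with $\int_G\Phi(\beta|f|)\,dx<\infty$ for some $\beta>0$, with the equivalent norms $N_\Phi(f)=\inf\{k>0:\int_G\Phi(|f|/k)\,dx\le 1\}$ and $\|f\|_\Phi=\sup\{\int_G|fg|\,dx: g\in L^\Psi(G),\ \int_G\Psi(|g|)\,dx\le 1\}$; similarly for $\Psi$. Write $\check g(x)=g(x^{-1})$ and $(f*g)(x)=\int_G f(y)g(y^{-1}x)\,dy$. The Orlicz Figà-Talamanca Herz algebra $A_\Phi(G)$ is the space of functions $u=\sum_n f_n*\check g_n$ with $f_n\in L^\Phi(G)$, $g_n\in L^\Psi(G)$, $\sum_n N_\Phi(f_n)\|g_n\|_\Psi<\infty$,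 normed by the infimum $\|u\|_{A_\Phi}$ of $\sum_n N_\Phi(f_n)\|g_n\|_\Psi$ over all such representations; with pointwise operations it is a commutative Banach algebra of functions in $C_0(G)$. *)

theory Defs
  imports "HOL-Analysis.Analysis" "HOL-Library.Function_Algebras"
begin

text \<open>
  A (Hausdorff) topological group is a type of class \<open>topological_group_add\<close> and \<open>t2_space\<close>.
  The class is written additively but is not assumed commutative: \<open>x + y\<close>, \<open>- x\<close> and \<open>0\<close>
  stand for the product $xy$, the inverse and the neutral element.
\<close>

text \<open>A left Haar measure is a nonzero left-invariant Radon measure on the Borel sets.\<close>

definition left_haar_measure :: "'a::{topological_group_add,t2_space} measure \<Rightarrow> bool" where
  "left_haar_measure \<mu> \<longleftrightarrow>
     sets \<mu> = sets borel \<and>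
     emeasure \<mu> UNIV \<noteq> 0 \<and>
     (\<forall>x. \<forall>A\<in>sets borel. emeasure \<mu> ((\<lambda>y. x + y) ` A) = emeasure \<mu> A) \<and>
     (\<forall>K. compact K \<longrightarrow> emeasure \<mu> K < \<infinity>) \<and>
     (\<forall>A\<in>sets borel. emeasure \<mu> A = (INF U\<in>{U. open U \<and> A \<subseteq> U}. emeasure \<mu> U)) \<and>
     (\<forall>U. open U \<longrightarrow> emeasure \<mu> U = (SUP K\<in>{K. compact K \<and> K \<subseteq> U}. emeasure \<mu> K))"

definition young_function :: "(real \<Rightarrow> ennreal) \<Rightarrow> bool" where
  "young_function \<Phi> \<longleftrightarrow>
     (\<forall>x. \<Phi> (- x) = \<Phi> x) \<and>
     (\<forall>x y. \<forall>t\<in>{0..1}. \<Phi> ((1 - t) * x + t * y) \<le> ennreal (1 - t) * \<Phi> x + ennreal t * \<Phi> y) \<and>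
     \<Phi> 0 = 0 \<and>
     (\<Phi> \<longlongrightarrow> \<infinity>) at_top"

text \<open>
  Subtraction on \<open>ennreal\<close> truncates at 0. This does not change the supremum,
  since the term for \<open>x = 0\<close> is already 0.
\<close>

definition complementary_young :: "(real \<Rightarrow> ennreal) \<Rightarrow> real \<Rightarrow> ennreal" where
  "complementary_young \<Phi> y = (SUP x\<in>{0..}. ennreal (x * \<bar>y\<bar>) - \<Phi> x)"

definition complementary_pair :: "(real \<Rightarrow> ennreal) \<Rightarrow> (real \<Rightarrow> ennreal) \<Rightarrow> bool" where
  "complementary_pair \<Phi> \<Psi> \<longleftrightarrow>
     young_function \<Phi> \<and> young_function \<Psi> \<and> \<Psi> = complementary_young \<Phi>"

text \<open>The condition depends on the group only through its compactness.\<close>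

definition Delta2_condition :: "'a::topological_space itself \<Rightarrow> (real \<Rightarrow> ennreal) \<Rightarrow> bool" where
  "Delta2_condition _ \<Phi> \<longleftrightarrow>
     (\<forall>x. \<Phi> x < \<infinity>) \<and>
     (if compact (UNIV :: 'a set)
      then \<exists>M>0. \<exists>x0>0. \<forall>x\<ge>x0. \<Phi> (2 * x) \<le> ennreal M * \<Phi> x
      else \<exists>M>0. \<forall>x\<ge>0. \<Phi> (2 * x) \<le> ennreal M * \<Phi> x)"

text \<open>
  Functions stand for their classes modulo null sets: the two norms below, and
  the convolutions \<open>convolution \<mu> f (check_fun g)\<close> at every point, do not depend on the representatives.
\<close>

definition orlicz_space :: "'a measure \<Rightarrow> (real \<Rightarrow> ennreal) \<Rightarrow> ('a \<Rightarrow> complex) set" where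
  "orlicz_space \<mu> \<Phi> =
     {f \<in> borel_measurable \<mu>. \<exists>\<beta>>0. (\<integral>\<^sup>+ x. \<Phi> (\<beta> * norm (f x)) \<partial>\<mu>) < \<infinity>}"

definition luxemburg_norm :: "'a measure \<Rightarrow> (real \<Rightarrow> ennreal) \<Rightarrow> ('a \<Rightarrow> complex) \<Rightarrow> ennreal" where
  "luxemburg_norm \<mu> \<Phi> f =
     (INF k\<in>{k::real. k > 0 \<and> (\<integral>\<^sup>+ x. \<Phi> (norm (f x) / k) \<partial>\<mu>) \<le> 1}. ennreal k)"

text \<open>
  The function argument \<open>\<Theta>\<close> is the complementary one: for a complementary pair \<open>(\<Phi>, \<Psi>)\<close>,
  the norm $\Vert f\Vert_\Phi$ is \<open>orlicz_norm \<mu> \<Psi> f\<close>, and $\Vert g\Vert_\Psi$ is \<open>orlicz_norm \<mu> \<Phi> g\<close>.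
\<close>

definition orlicz_norm :: "'a measure \<Rightarrow> (real \<Rightarrow> ennreal) \<Rightarrow> ('a \<Rightarrow> complex) \<Rightarrow> ennreal" where
  "orlicz_norm \<mu> \<Theta> f =
     (SUP h\<in>{h \<in> orlicz_space \<mu> \<Theta>. (\<integral>\<^sup>+ x. \<Theta> (norm (h x)) \<partial>\<mu>) \<le> 1}.
        \<integral>\<^sup>+ x. norm (f x * h x) \<partial>\<mu>)"

definition check_fun :: "('a::group_add \<Rightarrow> complex) \<Rightarrow> 'a \<Rightarrow> complex" where
  "check_fun g x = g (- x)"

definition convolution ::
  "'a::group_add measure \<Rightarrow> ('a \<Rightarrow> complex) \<Rightarrow> ('a \<Rightarrow> complex) \<Rightarrow> 'a \<Rightarrow> complex" where
  "convolution \<mu> f g x = (\<integral>y. f y * g (- y + x) \<partial>\<mu>)"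

text \<open>
  The series for \<open>u\<close> is summed pointwise; by Hoelder's inequality it then also converges
  absolutely and uniformly.
\<close>

definition herz_representations ::
  "'a::group_add measure \<Rightarrow> (real \<Rightarrow> ennreal) \<Rightarrow> (real \<Rightarrow> ennreal) \<Rightarrow> ('a \<Rightarrow> complex) \<Rightarrow>
     ((nat \<Rightarrow> 'a \<Rightarrow> complex) \<times> (nat \<Rightarrow> 'a \<Rightarrow> complex)) set" where
  "herz_representations \<mu> \<Phi> \<Psi> u =
     {(f, g). (\<forall>n. f n \<in> orlicz_space \<mu> \<Phi>) \<and> (\<forall>n. g n \<in> orlicz_space \<mu> \<Psi>) \<and>
        (\<Sum>n. luxemburg_norm \<mu> \<Phi> (f n) * orlicz_norm \<mu> \<Phi> (g n)) < \<infinity> \<and>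
        (\<forall>x. (\<lambda>n. convolution \<mu> (f n) (check_fun (g n)) x) sums u x)}"

definition herz_algebra ::
  "'a::group_add measure \<Rightarrow> (real \<Rightarrow> ennreal) \<Rightarrow> (real \<Rightarrow> ennreal) \<Rightarrow> ('a \<Rightarrow> complex) set" where
  "herz_algebra \<mu> \<Phi> \<Psi> = {u. herz_representations \<mu> \<Phi> \<Psi> u \<noteq> {}}"

text \<open>The norm of the algebra; finite-dimensionality does not refer to it.\<close>

definition herz_norm ::
  "'a::group_add measure \<Rightarrow> (real \<Rightarrow> ennreal) \<Rightarrow> (real \<Rightarrow> ennreal) \<Rightarrow> ('a \<Rightarrow> complex) \<Rightarrow> ennreal" where
  "herz_norm \<mu> \<Phi> \<Psi> u =
     (INF (f, g)\<in>herz_representations \<mu> \<Phi> \<Psi> u.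
        \<Sum>n. luxemburg_norm \<mu> \<Phi> (f n) * orlicz_norm \<mu> \<Phi> (g n))"

definition scale_fun :: "complex \<Rightarrow> ('a \<Rightarrow> complex) \<Rightarrow> 'a \<Rightarrow> complex" where
  "scale_fun c f = (\<lambda>x. c * f x)"

global_interpretation complex_fun: vector_space scale_fun
  by standard (auto simp: scale_fun_def fun_eq_iff algebra_simps)

definition finite_dimensional_fun_space :: "('a \<Rightarrow> complex) set \<Rightarrow> bool" where
  "finite_dimensional_fun_space V \<longleftrightarrow> (\<exists>B. finite B \<and> complex_fun.span B = V)"

end

theory Submission
  imports Defs
begin

text \<open>
  In an infinite group, take \<open>n\<close> distinct points \<open>s\<^sub>1, \<dots>, s\<^sub>n\<close> and a neighbourhood \<open>C\<close>
  of the neutral element, of finite measure and so small that the translates \<open>s\<^sub>i + C\<close> are disjoint.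
  The functions \<open>x \<mapsto> \<mu> ((s\<^sub>i + C) \<inter> (x + C))\<close> are convolutions of two indicator functions, hence lie in
  the algebra, and at the points \<open>s\<^sub>j\<close> they take the values \<open>\<mu> C\<close> times the identity matrix, so they
  are linearly independent. Conversely, over a finite group every function \<open>u\<close> is, up to the
  mass of a point, the convolution of \<open>u\<close> with the indicator function of the neutral element.
\<close>

section \<open>Young functions, finiteness of the two norms, and membership in the algebra\<close>

lemma young_function_scale_le:
  assumes "young_function \<Phi>" "0 \<le> t" "t \<le> 1"
  shows "\<Phi> (t * x) \<le> ennreal t * \<Phi> x"
proof -
  have "\<Phi> ((1 - t) * 0 + t * x) \<le> ennreal (1 - t) * \<Phi> 0 + ennreal t * \<Phi> x"
    using assms unfolding young_function_def by (metis atLeastAtMost_iff)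
  then show ?thesis
    using assms by (simp add: young_function_def)
qed

lemma young_function_mono:
  assumes "young_function \<Phi>" "0 \<le> x" "x \<le> y"
  shows "\<Phi> x \<le> \<Phi> y"
proof (cases "y = 0")
  case False
  then have "y > 0" using assms by simp
  then have "\<Phi> ((x / y) * y) \<le> ennreal (x / y) * \<Phi> y"
    using assms by (intro young_function_scale_le) auto
  also have "\<dots> \<le> 1 * \<Phi> y"
    using assms \<open>y > 0\<close> by (intro mult_right_mono) auto
  finally show ?thesis using \<open>y > 0\<close> by simp
qed (use assms in auto)

text \<open>A Young function is even, so it is monotone only on the nonnegative half-line.
  Precomposing with \<open>max 0\<close> makes it monotone everywhere without changing its values at
  norms, and the superlevel sets of a monotone function are intervals, hence Borel.\<close>

lemma young_function_comp_norm_measurable: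
  fixes f :: "'a \<Rightarrow> 'b::{real_normed_vector}"
  assumes "young_function \<Phi>" "f \<in> borel_measurable M"
  shows "(\<lambda>x. \<Phi> (norm (f x))) \<in> borel_measurable M"
proof -
  have "mono (\<lambda>x. \<Phi> (max 0 x))"
    by (intro monoI young_function_mono[OF assms(1)]) auto
  then have "(\<lambda>x. \<Phi> (max 0 x)) \<in> borel_measurable borel"
    by (intro borel_measurableI_greater)
      (auto intro!: real_interval_borel_measurable simp: is_interval_1 
        intro: less_le_trans[OF _ monoD[of "\<lambda>x. \<Phi> (max 0 x)"]])
  then have "(\<lambda>x. \<Phi> (max 0 (norm (f x)))) \<in> borel_measurable M"
    by (rule measurable_compose[OF measurable_compose[OF assms(2) borel_measurable_norm]])
  then show ?thesis by simp
qed

lemma Young_inequality: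
  assumes "complementary_pair \<Phi> \<Psi>" "0 \<le> x" "0 \<le> y"
  shows "ennreal (x * y) \<le> \<Phi> x + \<Psi> y"
proof -
  have "ennreal (x * \<bar>y\<bar>) - \<Phi> x \<le> \<Psi> y"
    using assms unfolding complementary_pair_def complementary_young_def by (auto intro: SUP_upper)
  then show ?thesis
    using assms by (simp add: ennreal_minus_le_iff add.commute)
qed

lemma luxemburg_norm_finite:
  assumes "young_function \<Phi>" "f \<in> borel_measurable \<mu>" "(\<integral>\<^sup>+ x. \<Phi> (norm (f x)) \<partial>\<mu>) < \<infinity>"
  shows "luxemburg_norm \<mu> \<Phi> f < \<infinity>"
proof -
  obtain I where I: "(\<integral>\<^sup>+ x. \<Phi> (norm (f x)) \<partial>\<mu>) = ennreal I" "0 \<le> I"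
    using assms(3) by (cases "(\<integral>\<^sup>+ x. \<Phi> (norm (f x)) \<partial>\<mu>)") auto
  \<comment> \<open>Convexity bounds \<open>\<Phi> (t / k)\<close> by \<open>\<Phi> t / k\<close>
    once \<open>k \<ge> 1\<close>; then \<open>k \<ge> I\<close> brings the integral down to at most
    1, so this \<open>k\<close> competes in the infimum.\<close>
  define k where "k = max 1 I"
  have k: "k \<ge> 1" "I \<le> k" by (auto simp: k_def)
  have "(\<integral>\<^sup>+ x. \<Phi> (norm (f x) / k) \<partial>\<mu>) \<le> (\<integral>\<^sup>+ x. ennreal (1 / k) * \<Phi> (norm (f x)) \<partial>\<mu>)"
    using young_function_scale_le[OF assms(1), of "1 / k"] k by (intro nn_integral_mono) auto
  also have "\<dots> = ennreal (1 / k) * ennreal I"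
    using young_function_comp_norm_measurable[OF assms(1,2)] I by (simp add: nn_integral_cmult)
  also have "\<dots> \<le> 1"
    using k I by (simp flip: ennreal_mult)
  finally have "luxemburg_norm \<mu> \<Phi> f \<le> ennreal k"
    unfolding luxemburg_norm_def using k by (intro INF_lower) auto
  also have "\<dots> < \<infinity>" by simp
  finally show ?thesis .
qed

text \<open>Integrate Young's inequality against a test function \<open>h\<close>: the
  \<open>\<Phi>\<close>-integral of \<open>h\<close> contributes at most 1, and the rest is the
  \<open>\<Psi>\<close>-integral of \<open>g\<close>, a bound independent of
  \<open>h\<close>.\<close>

lemma orlicz_norm_finite:
  assumes "complementary_pair \<Phi> \<Psi>" "g \<in> borel_measurable \<mu>" "(\<integral>\<^sup>+ x. \<Psi> (norm (g x)) \<partial>\<mu>) < \<infinity>"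
  shows "orlicz_norm \<mu> \<Phi> g < \<infinity>"
proof -
  have Y: "young_function \<Phi>" "young_function \<Psi>"
    using assms(1) by (auto simp: complementary_pair_def)
  have "orlicz_norm \<mu> \<Phi> g \<le> 1 + (\<integral>\<^sup>+ x. \<Psi> (norm (g x)) \<partial>\<mu>)"
    unfolding orlicz_norm_def
  proof (rule SUP_least)
    fix h assume h: "h \<in> {h \<in> orlicz_space \<mu> \<Phi>. (\<integral>\<^sup>+ x. \<Phi> (norm (h x)) \<partial>\<mu>) \<le> 1}"
    then have "h \<in> borel_measurable \<mu>" by (simp add: orlicz_space_def)
    note meas = young_function_comp_norm_measurable[OF Y(1) this]
      young_function_comp_norm_measurable[OF Y(2) assms(2)]
    have "ennreal (norm (g x * h x)) \<le> \<Phi> (norm (h x)) + \<Psi> (norm (g x))" for x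
      using Young_inequality[OF assms(1), of "norm (h x)" "norm (g x)"]
      by (simp add: norm_mult mult.commute)
    then have "(\<integral>\<^sup>+ x. norm (g x * h x) \<partial>\<mu>) \<le> (\<integral>\<^sup>+ x. \<Phi> (norm (h x)) + \<Psi> (norm (g x)) \<partial>\<mu>)"
      by (rule nn_integral_mono)
    also have "\<dots> = (\<integral>\<^sup>+ x. \<Phi> (norm (h x)) \<partial>\<mu>) + (\<integral>\<^sup>+ x. \<Psi> (norm (g x)) \<partial>\<mu>)"
      by (rule nn_integral_add[OF meas])
    also have "\<dots> \<le> 1 + (\<integral>\<^sup>+ x. \<Psi> (norm (g x)) \<partial>\<mu>)"
      using h by (intro add_right_mono) auto
    finally show "(\<integral>\<^sup>+ x. norm (g x * h x) \<partial>\<mu>) \<le> 1 + (\<integral>\<^sup>+ x. \<Psi> (norm (g x)) \<partial>\<mu>)" .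
  qed
  also have "\<dots> < \<infinity>" using assms(3) by (simp add: less_top)
  finally show ?thesis .
qed

text \<open>A single convolution is a series with one term, padded by zero functions. Finite
  integrals, with \<open>\<beta> = 1\<close>, give both membership in the Orlicz spaces and a finite
  product of norms.\<close>

lemma convolution_in_herz_algebra:
  assumes pair: "complementary_pair \<Phi> \<Psi>"
    and f: "f \<in> borel_measurable \<mu>" "(\<integral>\<^sup>+ x. \<Phi> (norm (f x)) \<partial>\<mu>) < \<infinity>"
    and g: "g \<in> borel_measurable \<mu>" "(\<integral>\<^sup>+ x. \<Psi> (norm (g x)) \<partial>\<mu>) < \<infinity>"
  shows "convolution \<mu> f (check_fun g) \<in> herz_algebra \<mu> \<Phi> \<Psi>"
proof -
  have Y: "young_function \<Phi>" "young_function \<Psi>" "\<Phi> 0 = 0" "\<Psi> 0 = 0"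
    using pair by (auto simp: complementary_pair_def young_function_def)
  define F where "F n = (if n = 0 then f else (\<lambda>_. 0))" for n :: nat
  define H where "H n = (if n = 0 then g else (\<lambda>_. 0))" for n :: nat
  have "F n \<in> orlicz_space \<mu> \<Phi>" "H n \<in> orlicz_space \<mu> \<Psi>" for n
    using f g Y by (auto simp: F_def H_def orlicz_space_def intro!: exI[of _ 1])
  moreover have "(\<Sum>n. luxemburg_norm \<mu> \<Phi> (F n) * orlicz_norm \<mu> \<Phi> (H n)) < \<infinity>"
  proof -
    \<comment> \<open>It suffices that one factor of each padding term vanishes: in
      \<open>ennreal\<close>, 0 times anything is 0.\<close>
    have "orlicz_norm \<mu> \<Phi> (H n) \<le> 0" if "n \<noteq> 0" for n
      using that unfolding orlicz_norm_def by (intro SUP_least) (simp add: H_def)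
    then have "(\<Sum>n. luxemburg_norm \<mu> \<Phi> (F n) * orlicz_norm \<mu> \<Phi> (H n)) =
        (\<Sum>n\<in>{0}. luxemburg_norm \<mu> \<Phi> (F n) * orlicz_norm \<mu> \<Phi> (H n))"
      by (intro suminf_finite) auto
    also have "\<dots> < \<infinity>"
      using luxemburg_norm_finite[OF Y(1) f] orlicz_norm_finite[OF pair g]
      by (simp add: F_def H_def ennreal_mult_less_top)
    finally show ?thesis .
  qed
  moreover have "(\<lambda>n. convolution \<mu> (F n) (check_fun (H n)) x) sums
      convolution \<mu> f (check_fun g) x" for x
    using sums_finite[of "{0}" "\<lambda>n. convolution \<mu> (F n) (check_fun (H n)) x"]
    by (simp add: F_def H_def convolution_def)
  ultimately show ?thesis
    unfolding herz_algebra_def herz_representations_def by blast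
qed

section \<open>Topology of the group and positivity of Haar measure on open sets\<close>

lemma open_left_translate:
  fixes U :: "'a::topological_group_add set"
  assumes "open U"
  shows "open ((\<lambda>y. x + y) ` U)"
proof -
  have "(\<lambda>y. x + y) ` U = (\<lambda>y. - x + y) -` U"
  proof (intro set_eqI iffI)
    fix z assume "z \<in> (\<lambda>y. - x + y) -` U"
    then show "z \<in> (\<lambda>y. x + y) ` U"
      by (intro image_eqI[of _ _ "- x + z"]) auto
  qed auto
  also have "open \<dots>"
    using assms by (intro open_vimage continuous_intros)
  finally show ?thesis .
qed

lemma left_haar_measureD:
  assumes "left_haar_measure \<mu>"
  shows "sets \<mu> = sets borel"
    and "emeasure \<mu> UNIV \<noteq> 0"
    and "A \<in> sets borel \<Longrightarrow> emeasure \<mu> ((\<lambda>y. x + y) ` A) = emeasure \<mu> A"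
    and "compact K \<Longrightarrow> emeasure \<mu> K < \<infinity>"
    and "open U \<Longrightarrow> emeasure \<mu> U = (SUP K\<in>{K. compact K \<and> K \<subseteq> U}. emeasure \<mu> K)"
proof -
  note haar = assms[unfolded left_haar_measure_def]
  show "sets \<mu> = sets borel"
    using haar by (elim conjE)
  show "emeasure \<mu> UNIV \<noteq> 0"
    using haar by (elim conjE)
  have "\<forall>x. \<forall>A\<in>sets borel. emeasure \<mu> ((\<lambda>y. x + y) ` A) = emeasure \<mu> A"
    using haar by (elim conjE)
  then show "A \<in> sets borel \<Longrightarrow> emeasure \<mu> ((\<lambda>y. x + y) ` A) = emeasure \<mu> A"
    by blast
  have "\<forall>K. compact K \<longrightarrow> emeasure \<mu> K < \<infinity>"
    using haar by (elim conjE)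
  then show "compact K \<Longrightarrow> emeasure \<mu> K < \<infinity>"
    by blast
  have "\<forall>U. open U \<longrightarrow> emeasure \<mu> U = (SUP K\<in>{K. compact K \<and> K \<subseteq> U}. emeasure \<mu> K)"
    using haar by (elim conjE)
  then show "open U \<Longrightarrow> emeasure \<mu> U = (SUP K\<in>{K. compact K \<and> K \<subseteq> U}. emeasure \<mu> K)"
    by blast
qed

text \<open>If \<open>U\<close> were null, all its left translates would be null. Finitely many of
  them cover any given compact set, so all compact sets would be null, and inner regularity on the
  whole group would make the measure zero.\<close>

lemma left_haar_measure_open_pos:
  fixes \<mu> :: "'a::{topological_group_add,t2_space} measure"
  assumes haar: "left_haar_measure \<mu>" and U: "open U" "U \<noteq> {}"
  shows "emeasure \<mu> U > 0"
proof (rule ccontr)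
  assume "\<not> emeasure \<mu> U > 0"
  then have "emeasure \<mu> U = 0" by simp
  have [simp]: "sets \<mu> = sets borel"
    using haar by (rule left_haar_measureD)
  have null: "(\<lambda>y. x + y) ` U \<in> null_sets \<mu>" for x
    using left_haar_measureD(3)[OF haar] U(1) open_left_translate[OF U(1)] \<open>emeasure \<mu> U = 0\<close>
    by (simp add: null_sets_def)
  obtain u where "u \<in> U" using U by blast
  have zero: "emeasure \<mu> K = 0" if "compact K" for K
  proof -
    \<comment> \<open>Translation by \<open>k - u\<close> carries the chosen point \<open>u\<close>
      of \<open>U\<close> to \<open>k\<close>.\<close>
    have cover: "\<exists>x. k \<in> (\<lambda>y. x + y) ` U" for k
      using \<open>u \<in> U\<close> by (intro exI[of _ "k - u"] image_eqI[of _ _ u]) auto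
    then have "K \<subseteq> (\<Union>x\<in>UNIV. (\<lambda>y. x + y) ` U)" by blast
    then obtain T where T: "finite T" "K \<subseteq> (\<Union>x\<in>T. (\<lambda>y. x + y) ` U)"
      by (rule compactE_image[of K UNIV "\<lambda>x. (\<lambda>y. x + y) ` U",
          OF \<open>compact K\<close> open_left_translate[OF U(1)]])
    have "K \<in> sets \<mu>"
      using compact_imp_closed[OF \<open>compact K\<close>] by simp
    moreover have "(\<Union>x\<in>T. (\<lambda>y. x + y) ` U) \<in> null_sets \<mu>"
      by (rule null_sets_UN'[of T "\<lambda>x. (\<lambda>y. x + y) ` U", OF countable_finite[OF T(1)] null])
    ultimately show ?thesis
      by (intro null_setsD1 null_sets_subset[OF _ _ T(2)])
  qed
  have "emeasure \<mu> UNIV = (SUP K\<in>{K. compact K \<and> K \<subseteq> UNIV}. emeasure \<mu> K)"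
    by (rule left_haar_measureD(5)[OF haar open_UNIV])
  also have "\<dots> \<le> 0" by (rule SUP_least) (simp add: zero)
  finally show False using left_haar_measureD(2)[OF haar] by simp
qed

text \<open>This is continuity of subtraction at \<open>(0, 0)\<close>: intersect the two sides of
  an open box mapped into \<open>W\<close>.\<close>

lemma small_neighbourhood_minus:
  fixes W :: "'a::topological_group_add set"
  assumes "open W" "0 \<in> W"
  obtains V where "open V" "0 \<in> V" "\<And>a b. a \<in> V \<Longrightarrow> b \<in> V \<Longrightarrow> a - b \<in> W"
proof -
  have "open ((\<lambda>p::'a \<times> 'a. fst p - snd p) -` W)"
    using assms(1) by (intro open_vimage continuous_intros)
  then obtain A B where "open A" "open B" "(0, 0) \<in> A \<times> B"
    "A \<times> B \<subseteq> (\<lambda>p. fst p - snd p) -` W"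
    using assms(2) by (elim open_prod_elim[where x = "(0, 0)"]) auto
  then show ?thesis
    by (intro that[of "A \<inter> B"]) auto
qed

section \<open>Linearly independent functions in the algebra\<close>

lemma sum_scale_fun_apply:
  "(\<Sum>i\<in>S. scale_fun (c i) (v i)) x = (\<Sum>i\<in>S. c i * v i x)"
  by (induction S rule: infinite_finite_induct) (auto simp: scale_fun_def)

text \<open>Evaluating a vanishing linear combination at \<open>s\<close> leaves only the term of
  \<open>u s\<close>, whose coefficient must therefore be 0. So the functions are independent, and
  an independent family in the span of \<open>B\<close> is no larger than \<open>B\<close>.\<close>

lemma biorthogonal_card_le:
  assumes "finite B" "finite S"
    and span: "\<And>s. s \<in> S \<Longrightarrow> u s \<in> complex_fun.span B"
    and diag: "\<And>s. s \<in> S \<Longrightarrow> u s s \<noteq> 0"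
    and off: "\<And>s t. s \<in> S \<Longrightarrow> t \<in> S \<Longrightarrow> s \<noteq> t \<Longrightarrow> u s t = 0"
  shows "card S \<le> card B"
proof -
  \<comment> \<open>If \<open>u s = u t\<close> for distinct \<open>s\<close> and \<open>t\<close>,
    then \<open>u s s = u t s = 0\<close>, against \<open>diag\<close>.\<close>
  have inj: "inj_on u S"
    using diag off by (metis inj_onI)
  have "complex_fun.independent (u ` S)"
  proof -
    have False if c: "(\<Sum>v\<in>u ` S. scale_fun (c v) v) = 0" and s: "s \<in> S" "c (u s) \<noteq> 0" for c s
    proof -
      have "0 = (\<Sum>r\<in>S. scale_fun (c (u r)) (u r)) s"
        using c inj by (simp add: sum.reindex)
      also have "\<dots> = (\<Sum>r\<in>S. c (u r) * u r s)"
        by (rule sum_scale_fun_apply)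
      also have "\<dots> = (\<Sum>r\<in>{s}. c (u r) * u r s)"
        using \<open>finite S\<close> s off by (intro sum.mono_neutral_right) auto
      finally show False using s diag by simp
    qed
    then show ?thesis
      using \<open>finite S\<close> by (subst complex_fun.dependent_finite) auto
  qed
  then have "card (u ` S) \<le> card B"
    using complex_fun.independent_span_bound[OF \<open>finite B\<close>] span by auto
  then show ?thesis using inj by (simp add: card_image)
qed

text \<open>The reflection turns the argument \<open>- y + x\<close> into \<open>- x + y\<close>,
  which lies in \<open>C\<close> exactly when \<open>y\<close> lies in the translate of
  \<open>C\<close> by \<open>x\<close>. For an intersection of infinite measure, the integral and
  \<open>measure\<close> both default to 0.\<close>

lemma convolution_indicator:
  fixes \<mu> :: "'a::group_add measure"
  assumes "A \<inter> (\<lambda>y. x + y) ` C \<in> sets \<mu>"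
  shows "convolution \<mu> (indicator A) (check_fun (indicator C)) x =
    of_real (measure \<mu> (A \<inter> (\<lambda>y. x + y) ` C))"
proof -
  have "- (- y + x) \<in> C \<longleftrightarrow> y \<in> (\<lambda>y. x + y) ` C" for y
    by (force simp: minus_add image_iff simp flip: add.assoc intro: bexI[of _ "- x + y"])
  then have "indicator A y * check_fun (indicator C) (- y + x) =
      indicator (A \<inter> (\<lambda>y. x + y) ` C) y *\<^sub>R (1 :: complex)" for y
    by (auto simp: check_fun_def indicator_def)
  then show ?thesis
    using assms sets.sets_into_space[OF assms]
    by (simp add: convolution_def Int_absorb1 Int_absorb2 scaleR_conv_of_real)
qed

text \<open>An infinite group has a set \<open>S\<close> with one point more than \<open>B\<close>,
  which this bound rules out.\<close>

lemma card_le_herz_algebra_span: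
  fixes \<mu> :: "'a::{topological_group_add,t2_space} measure"
  assumes lc: "locally_compact_space (euclidean :: 'a topology)"
    and haar: "left_haar_measure \<mu>"
    and pair: "complementary_pair \<Phi> \<Psi>"
    and fin: "\<Phi> 1 < \<infinity>" "\<Psi> 1 < \<infinity>"
    and B: "finite B" "complex_fun.span B = herz_algebra \<mu> \<Phi> \<Psi>"
    and S: "finite (S :: 'a set)"
  shows "card S \<le> card B"
proof -
  have [simp]: "sets \<mu> = sets borel"
    using haar by (rule left_haar_measureD)
  have Y0: "\<Phi> 0 = 0" "\<Psi> 0 = 0"
    using pair by (auto simp: complementary_pair_def young_function_def)
  obtain U K where UK: "open U" "compact K" "0 \<in> U" "U \<subseteq> (K :: 'a set)"
    using lc unfolding locally_compact_space_def by simp metis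
  \<comment> \<open>A common point \<open>s + a = t + b\<close> of two translates gives
    \<open>a - b = - s + t\<close>. Removing these finitely many differences, all nonzero, leaves an
    open neighbourhood of 0 that forbids such collisions.\<close>
  define W where "W = - {- s + t | s t. s \<in> S \<and> t \<in> S \<and> s \<noteq> t}"
  have "{- s + t | s t. s \<in> S \<and> t \<in> S \<and> s \<noteq> t} \<subseteq> (\<lambda>(s, t). - s + t) ` (S \<times> S)"
    by auto
  then have "open W"
    unfolding W_def using S
    by (intro open_Compl finite_imp_closed) (erule finite_subset, simp)
  moreover have "0 \<in> W"
    by (auto simp: W_def) (metis add_minus_cancel add_0_right)
  ultimately obtain V where V: "open V" "0 \<in> V" "\<And>a b. a \<in> V \<Longrightarrow> b \<in> V \<Longrightarrow> a - b \<in> W"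
    by (rule small_neighbourhood_minus) blast
  \<comment> \<open>\<open>U\<close> lies in a compact set and makes the measure of \<open>C\<close>
    finite; \<open>V\<close> keeps differences of points of \<open>C\<close> in \<open>W\<close>,
    which makes the translates disjoint.\<close>
  define C where "C = U \<inter> V"
  define T where "T s = (\<lambda>y. s + y) ` C" for s
  have "open C" "0 \<in> C" using UK V by (auto simp: C_def)
  have "open (T s)" for s
    unfolding T_def by (rule open_left_translate) fact
  then have T_sets [measurable]: "T s \<in> sets borel" for s by simp
  have C_sets [measurable]: "C \<in> sets borel" using \<open>open C\<close> by simp
  have C_pos: "emeasure \<mu> C > 0"
    using left_haar_measure_open_pos[OF haar \<open>open C\<close>] \<open>0 \<in> C\<close> by auto
  have "emeasure \<mu> C \<le> emeasure \<mu> K"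
    using UK compact_imp_closed[OF \<open>compact K\<close>] by (intro emeasure_mono) (auto simp: C_def)
  also have "\<dots> < \<infinity>" using left_haar_measureD(4)[OF haar] UK by blast
  finally have C_fin: "emeasure \<mu> C < \<infinity>" .
  have T_measure: "emeasure \<mu> (T s) = emeasure \<mu> C" for s
    unfolding T_def using left_haar_measureD(3)[OF haar C_sets] .
  have disj: "T s \<inter> T t = {}" if "s \<in> S" "t \<in> S" "s \<noteq> t" for s t
  proof (rule ccontr)
    assume "T s \<inter> T t \<noteq> {}"
    then obtain a b where ab: "a \<in> C" "b \<in> C" "s + a = t + b"
      by (auto simp: T_def)
    then have "a - b = - s + t"
      by (metis add.assoc add_diff_cancel minus_add_cancel)
    moreover have "a - b \<in> W" using ab V by (auto simp: C_def)
    ultimately show False using that by (auto simp: W_def)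
  qed
  \<comment> \<open>An indicator takes only the values 0 and 1, so finiteness of
    \<open>\<Phi> 1\<close> and \<open>\<Psi> 1\<close> is what puts indicators of sets of finite
    measure within reach of \<open>convolution_in_herz_algebra\<close>.\<close>
  have int: "(\<integral>\<^sup>+ x. \<Theta> (norm (indicator A x :: complex)) \<partial>\<mu>) = \<Theta> 1 * emeasure \<mu> A"
    if "\<Theta> 0 = 0" "A \<in> sets borel" for A and \<Theta> :: "real \<Rightarrow> ennreal"
  proof -
    have "\<Theta> (norm (indicator A x :: complex)) = \<Theta> 1 * indicator A x" for x
      using that by (simp add: indicator_def)
    then show ?thesis using that by (simp add: nn_integral_cmult_indicator)
  qed
  define u where "u s = convolution \<mu> (indicator (T s)) (check_fun (indicator C))" for s
  have u_eq: "u s x = of_real (measure \<mu> (T s \<inter> T x))" for s x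
    unfolding u_def T_def[of x]
    by (rule convolution_indicator) (use T_sets in \<open>auto simp flip: T_def\<close>)
  show ?thesis
  proof (rule biorthogonal_card_le[OF B(1) S])
    fix s
    have "indicator (T s) \<in> borel_measurable \<mu>" "indicator C \<in> borel_measurable \<mu>"
      by (auto intro!: borel_measurable_indicator)
    then have "u s \<in> herz_algebra \<mu> \<Phi> \<Psi>"
      unfolding u_def using fin C_fin T_measure Y0
      by (intro convolution_in_herz_algebra[OF pair]) (auto simp: int ennreal_mult_less_top)
    then show "u s \<in> complex_fun.span B" using B by simp
    \<comment> \<open>The value is the real measure of \<open>T s\<close>, nonzero because the
      measure of \<open>C\<close> is both positive and finite; an infinite one would be read as
      0.\<close>
    show "u s s \<noteq> 0"
      using C_pos C_fin T_measure by (auto simp: u_eq measure_def enn2real_eq_0_iff)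
  next
    fix s t assume "s \<in> S" "t \<in> S" "s \<noteq> t"
    then show "u s t = 0" by (simp add: u_eq disj)
  qed
qed

section \<open>Finite groups\<close>

lemma herz_algebra_finite_group:
  fixes \<mu> :: "'a::{topological_group_add,t2_space} measure"
  assumes finite: "finite (UNIV :: 'a set)"
    and haar: "left_haar_measure \<mu>"
    and pair: "complementary_pair \<Phi> \<Psi>"
    and fin: "\<And>x. \<Phi> x < \<infinity>" "\<And>x. \<Psi> x < \<infinity>"
  shows "herz_algebra \<mu> \<Phi> \<Psi> = UNIV"
proof -
  \<comment> \<open>A finite Hausdorff space is discrete, so every set is Borel and every function
    is measurable.\<close>
  have open_all: "open A" for A :: "'a set"
    using finite finite_imp_closed[of "- A"] by (simp add: closed_def finite_subset[OF subset_UNIV])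
  have sets_eq: "sets \<mu> = UNIV"
    using left_haar_measureD(1)[OF haar] open_all by (metis UNIV_eq_I borel_open)
  then have space_eq: "space \<mu> = UNIV"
    by (metis UNIV_I sets.sets_into_space top.extremum_uniqueI)
  have meas: "f \<in> borel_measurable \<mu>" for f :: "'a \<Rightarrow> complex"
    by (auto simp: measurable_def sets_eq space_eq)
  have mass_finite: "emeasure \<mu> UNIV < \<infinity>"
    by (intro left_haar_measureD(4)[OF haar] finite_imp_compact finite)
  \<comment> \<open>The integrand is dominated by a constant, the sum of its values over the whole
    group, and the total mass is finite.\<close>
  have int: "(\<integral>\<^sup>+ x. \<Theta> (norm (f x)) \<partial>\<mu>) < \<infinity>"
    if "\<And>x. \<Theta> x < \<infinity>" for f :: "'a \<Rightarrow> complex" and \<Theta> :: "real \<Rightarrow> ennreal"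
  proof -
    have "(\<integral>\<^sup>+ x. \<Theta> (norm (f x)) \<partial>\<mu>) \<le> (\<integral>\<^sup>+ x. (\<Sum>y\<in>UNIV. \<Theta> (norm (f y))) \<partial>\<mu>)"
      using finite by (intro nn_integral_mono member_le_sum) auto
    also have "\<dots> < \<infinity>"
      using that mass_finite finite by (simp add: space_eq ennreal_mult_less_top)
    finally show ?thesis .
  qed
  have "u \<in> herz_algebra \<mu> \<Phi> \<Psi>" for u
  proof -
    \<comment> \<open>By left invariance every point has this mass. It is positive since
      \<open>{0}\<close> is open and finite since \<open>{0}\<close> is compact, so dividing by
      \<open>c\<close> is legitimate.\<close>
    define c where "c = measure \<mu> {0}"
    have "emeasure \<mu> {0} > 0"
      using left_haar_measure_open_pos[OF haar open_all] by simp
    moreover have "emeasure \<mu> {0} < \<infinity>"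
      by (intro left_haar_measureD(4)[OF haar]) simp
    ultimately have "c \<noteq> 0" by (auto simp: c_def measure_def enn2real_eq_0_iff)
    have mass: "emeasure \<mu> {x} = emeasure \<mu> {0}" for x
    proof -
      have "emeasure \<mu> ((\<lambda>y. x + y) ` {0}) = emeasure \<mu> {0}"
        by (intro left_haar_measureD(3)[OF haar]) simp
      then show ?thesis by simp
    qed
    define f where "f x = u x / of_real c" for x
    have "convolution \<mu> f (check_fun (indicator {0})) x = u x" for x
    proof -
      \<comment> \<open>After reflection the second factor is the indicator of 0 at
        \<open>- x + y\<close>, so only \<open>y = x\<close> contributes to the integral.\<close>
      have "- x + y = 0 \<longleftrightarrow> y = x" for y
        by (metis add_minus_cancel add_0_right left_minus)
      then have "f y * check_fun (indicator {0}) (- y + x) = indicator {x} y *\<^sub>R f x" for y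
        by (auto simp: check_fun_def indicator_def minus_add)
      then have "convolution \<mu> f (check_fun (indicator {0})) x = measure \<mu> {x} *\<^sub>R f x"
        using left_haar_measureD(4)[OF haar, of "{x}"]
        by (simp add: convolution_def sets_eq space_eq less_top)
      also have "\<dots> = of_real c * f x"
        by (simp add: c_def measure_def mass[of x] scaleR_conv_of_real)
      also have "\<dots> = u x"
        using \<open>c \<noteq> 0\<close> by (simp add: f_def)
      finally show ?thesis .
    qed
    then have "u = convolution \<mu> f (check_fun (indicator {0}))" by auto
    also have "\<dots> \<in> herz_algebra \<mu> \<Phi> \<Psi>"
      by (intro convolution_in_herz_algebra[OF pair] meas int fin)
    finally show ?thesis .
  qed
  then show ?thesis by auto
qed

lemma finite_dimensional_UNIV:
  assumes "finite (UNIV :: 'a set)"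
  shows "finite_dimensional_fun_space (UNIV :: ('a \<Rightarrow> complex) set)"
proof -
  let ?B = "range (\<lambda>a::'a. indicator {a} :: 'a \<Rightarrow> complex)"
  have "u \<in> complex_fun.span ?B" for u
  proof -
    have "u = (\<Sum>a\<in>UNIV. scale_fun (u a) (indicator {a}))"
      using assms by (auto simp: fun_eq_iff sum_scale_fun_apply indicator_def)
    also have "\<dots> \<in> complex_fun.span ?B"
      by (intro complex_fun.span_sum complex_fun.span_scale complex_fun.span_base) auto
    finally show ?thesis .
  qed
  then show ?thesis
    unfolding finite_dimensional_fun_space_def using assms by (intro exI[of _ ?B]) auto
qed

theorem theorem3p8:
  fixes \<mu> :: "'a::{topological_group_add,t2_space} measure"
    and \<Phi> \<Psi> :: "real \<Rightarrow> ennreal"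
  assumes "locally_compact_space (euclidean :: 'a topology)"
    and "left_haar_measure \<mu>"
    and "complementary_pair \<Phi> \<Psi>"
    and "Delta2_condition TYPE('a) \<Phi>"
    and "Delta2_condition TYPE('a) \<Psi>"
  shows "finite_dimensional_fun_space (herz_algebra \<mu> \<Phi> \<Psi>) \<longleftrightarrow> finite (UNIV :: 'a set)"
proof
  \<comment> \<open>Finite values serve both directions: for indicators of sets of finite measure in
    the infinite case, and for arbitrary functions on a finite group.\<close>
  have fin: "\<Phi> x < \<infinity>" "\<Psi> x < \<infinity>" for x
    using assms(4,5) by (auto simp: Delta2_condition_def)
  show "finite_dimensional_fun_space (herz_algebra \<mu> \<Phi> \<Psi>)" if "finite (UNIV :: 'a set)"
    using finite_dimensional_UNIV[OF that] herz_algebra_finite_group[OF that assms(2,3) fin]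
    by simp
  show "finite (UNIV :: 'a set)"
    if fin_dim: "finite_dimensional_fun_space (herz_algebra \<mu> \<Phi> \<Psi>)"
  proof (rule ccontr)
    assume "infinite (UNIV :: 'a set)"
    obtain B where B: "finite B" "complex_fun.span B = herz_algebra \<mu> \<Phi> \<Psi>"
      using fin_dim by (auto simp: finite_dimensional_fun_space_def)
    obtain S :: "'a set" where "finite S" "card S = Suc (card B)"
      using infinite_arbitrarily_large[OF \<open>infinite UNIV\<close>] by blast
    then show False
      using card_le_herz_algebra_span[OF assms(1-3) fin B] by fastforce
  qed
qed

end
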